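(* For every integer $n\ge 8$ with $n\equiv 0 \pmod 8$, there exists a $2$-connected cubic $n$-vertex graph $G$ with $\mathrm{minexc}(G)=n/4$.
   Context: All graphs are finite and simple. A graph is cubic if every vertex has degree exactly three. A graph is $2$-connected if it has at least three vertices and is connected and remains connected after the removal of any single vertex. A graph is Eulerian if all its vertices have even degree (it need not be connected). A subgraph of $G$ is spanning if it contains all vertices of $G$ (possibly some as isolated vertices). For a graph $F$, let $c(F)$ be the number of its components with at least two vertices and $i(F)$ the number of its isolated vertices, and let $\mathrm{exc}(F)=2c(F)+i(F)$. For a graph $G$ with maximum degree at most three, $\mathrm{minexc}(G)$ is the minimum of $\mathrm{exc}(F)$ over all spanning Eulerian subgraphs $F$ of $G$. *)

theory Defs
  imports "Graph_Theory.Graph_Theory"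
begin

text \<open>
  A finite simple graph is a \<open>pair_graph\<close>: a finite, loop-free, symmetric set of pairs,
  in which an undirected edge is represented by its two orientations. Hence the degree
  of a vertex is its out-degree, and the connected components are the strongly connected
  components.
\<close>

definition cubic :: "'a pair_pre_digraph \<Rightarrow> bool" where
  "cubic G \<longleftrightarrow> (\<forall>v \<in> pverts G. out_degree G v = 3)"

definition two_connected :: "'a pair_pre_digraph \<Rightarrow> bool" where
  "two_connected G \<longleftrightarrow>
     card (pverts G) \<ge> 3 \<and> Digraph_Component.connected G \<and>
     (\<forall>v \<in> pverts G. Digraph_Component.connected (pre_digraph.del_vert G v))"

definition eulerian :: "'a pair_pre_digraph \<Rightarrow> bool" where
  "eulerian F \<longleftrightarrow> (\<forall>v \<in> pverts F. even (out_degree F v))"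

definition num_nontrivial_components :: "'a pair_pre_digraph \<Rightarrow> nat" where
  "num_nontrivial_components F = card {S \<in> pre_digraph.sccs_verts F. card S \<ge> 2}"

definition num_isolated :: "'a pair_pre_digraph \<Rightarrow> nat" where
  "num_isolated F = card {v \<in> pverts F. out_degree F v = 0}"

definition exc :: "'a pair_pre_digraph \<Rightarrow> nat" where
  "exc F = 2 * num_nontrivial_components F + num_isolated F"

definition spanning_eulerian_subgraphs :: "'a pair_pre_digraph \<Rightarrow> 'a pair_pre_digraph set" where
  "spanning_eulerian_subgraphs G = {F. pair_graph F \<and> spanning F G \<and> eulerian F}"

definition minexc :: "'a pair_pre_digraph \<Rightarrow> nat" where
  "minexc G = Min (exc ` spanning_eulerian_subgraphs G)"

text \<open>The minimum ranges over a finite nonempty set, so \<^const>\<open>Min\<close> is meaningful.\<close>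

lemma finite_spanning_eulerian_subgraphs:
  assumes "pair_graph G"
  shows "finite (spanning_eulerian_subgraphs G)"
proof (rule finite_subset)
  interpret pair_graph G by (rule assms)
  show "spanning_eulerian_subgraphs G
      \<subseteq> (\<lambda>E. \<lparr>pverts = pverts G, parcs = E\<rparr>) ` Pow (parcs G)"
  proof
    fix F assume "F \<in> spanning_eulerian_subgraphs G"
    then have "pverts F = pverts G" "parcs F \<subseteq> parcs G"
      by (auto simp: spanning_eulerian_subgraphs_def spanning_def subgraph_def)
    then show "F \<in> (\<lambda>E. \<lparr>pverts = pverts G, parcs = E\<rparr>) ` Pow (parcs G)"
      by (intro image_eqI[where x = "parcs F"]) auto
  qed
  show "finite ((\<lambda>E. \<lparr>pverts = pverts G, parcs = E\<rparr>) ` Pow (parcs G))"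
    using pair_finite_arcs by simp
qed

lemma spanning_eulerian_subgraphs_nonempty:
  assumes "pair_graph G"
  shows "spanning_eulerian_subgraphs G \<noteq> {}"
proof -
  interpret pair_graph G by (rule assms)
  let ?F = "\<lparr>pverts = pverts G, parcs = {}\<rparr>"
  have F: "pair_graph ?F"
    using pair_finite_verts by unfold_locales (auto simp: symmetric_def sym_def)
  then interpret F: pair_graph ?F .
  have "spanning ?F G"
    using wf_digraph_axioms F.wf_digraph_axioms
    by (auto simp: spanning_def subgraph_def compatible_def)
  moreover have "eulerian ?F"
    by (auto simp: eulerian_def out_degree_def out_arcs_def)
  ultimately show ?thesis
    using F by (auto simp: spanning_eulerian_subgraphs_def)
qed

end

theory Submission
  imports Defs
begin

text \<open>
  For \<open>n = 8 * k\<close> take a ladder whose rungs are alternately diamonds (\<open>K\<^sub>4\<close> minus an edge, attached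
  at its two vertices of degree two) and single edges, and close it with a diamond at both ends.
  Cutting both rails at the same height is a 2-edge cut, so an Eulerian subgraph \<open>F\<close> contains both
  rail edges there or neither. Cut the ladder without its upper closing diamond into \<open>k\<close> levels: the
  lower closing diamond, and then each diamond rung together with the edge rung above it. The lowest
  level contains the start of a component or four isolated vertices. Now consider a higher level.
  If \<open>F\<close> does not traverse the diamond rung, then \<open>F\<close> restricted to the diamond is a union of
  components. If \<open>F\<close> traverses it and uses no rail edge below, then its component starts at this
  level. Otherwise \<open>F\<close> uses no rail edge between the two rungs, and the edge rung either lies in a
  component starting at this level or has two isolated ends. In every case the level contributes at
  least 2 to the excess. Conversely, the ladder has a 2-factor with \<open>k\<close> cycles.
\<close>


section \<open>The ladder graph and its adjacency\<close>

text \<open>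
  The vertices are \<open>4, \<dots>, 8 * k + 3\<close>. For \<open>1 \<le> j \<le> k\<close> the vertices \<open>8 * j, \<dots>, 8 * j + 3\<close> form a
  diamond with terminals \<open>8 * j\<close> and \<open>8 * j + 3\<close>; another diamond, with terminals 6 and 7, is formed
  by \<open>4, \<dots>, 7\<close>. For \<open>1 \<le> j < k\<close> the left rail of the ladder runs through \<open>8 * j + 4\<close> and \<open>8 * j + 6\<close>,
  the right rail through \<open>8 * j + 5\<close> and \<open>8 * j + 7\<close>; the lower two of these are joined by the \<open>j\<close>-th
  diamond, the upper two by an edge. Entry \<open>r\<close> of the list is the neighbourhood of \<open>8 * j + r\<close>.
\<close>

definition nbrs_list :: "nat \<Rightarrow> nat \<Rightarrow> nat set list" where
  "nbrs_list k j =
    [{8 * j + 2, 8 * j + 1, if j < k then 8 * j + 4 else 8 * j - 2},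
     {8 * j + 3, 8 * j, 8 * j + 2},
     {8 * j, 8 * j + 1, 8 * j + 3},
     {8 * j + 1, 8 * j + 2, if j < k then 8 * j + 5 else 8 * j - 1},
     if j = 0 then {6, 5, 7} else {8 * j + 6, 8 * j, 8 * j - 2},
     if j = 0 then {7, 4, 6} else {8 * j + 7, 8 * j + 3, 8 * j - 1},
     {8 * j + 4, if j = 0 then 5 else 8 * j + 7, if j + 1 < k then 8 * j + 12 else 8 * j + 8},
     {8 * j + 5, if j = 0 then 4 else 8 * j + 6, if j + 1 < k then 8 * j + 13 else 8 * j + 11}]"

definition nbrs :: "nat \<Rightarrow> nat \<Rightarrow> nat set" where
  "nbrs k v = nbrs_list k (v div 8) ! (v mod 8)"

definition ladder :: "nat \<Rightarrow> nat pair_pre_digraph" where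
  "ladder k = \<lparr>pverts = {4..<8 * k + 4}, parcs = {(u, w). u \<in> {4..<8 * k + 4} \<and> w \<in> nbrs k u}\<rparr>"

lemma ladder_simps [simp]:
  "pverts (ladder k) = {4..<8 * k + 4}"
  "(u, w) \<in> parcs (ladder k) \<longleftrightarrow> 4 \<le> u \<and> u < 8 * k + 4 \<and> w \<in> nbrs k u"
  by (auto simp: ladder_def)

text \<open>The form in which simp evaluates adjacency. The test \<open>j < k\<close> separates the
  diamond rungs from the upper closing diamond \<open>j = k\<close>, whose terminals hang on the
  rail ends \<open>8 * k - 2\<close> and \<open>8 * k - 1\<close>. The premise \<open>0 < j\<close>
  sets apart the lower closing diamond, which is given by the numerals 4 to 7.\<close>

lemma nbrs_simps [simp]:
  "nbrs k (8 * j) = {8 * j + 2, 8 * j + 1, if j < k then 8 * j + 4 else 8 * j - 2}"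
  "nbrs k (8 * j + 1) = {8 * j + 3, 8 * j, 8 * j + 2}"
  "nbrs k (8 * j + 2) = {8 * j, 8 * j + 1, 8 * j + 3}"
  "nbrs k (8 * j + 3) = {8 * j + 1, 8 * j + 2, if j < k then 8 * j + 5 else 8 * j - 1}"
  "0 < j \<Longrightarrow> nbrs k (8 * j + 4) = {8 * j + 6, 8 * j, 8 * j - 2}"
  "0 < j \<Longrightarrow> nbrs k (8 * j + 5) = {8 * j + 7, 8 * j + 3, 8 * j - 1}"
  "0 < j \<Longrightarrow> nbrs k (8 * j + 6) =
     {8 * j + 4, 8 * j + 7, if j + 1 < k then 8 * j + 12 else 8 * j + 8}"
  "0 < j \<Longrightarrow> nbrs k (8 * j + 7) =
     {8 * j + 5, 8 * j + 6, if j + 1 < k then 8 * j + 13 else 8 * j + 11}"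
  "nbrs k 4 = {6, 5, 7}"
  "nbrs k 5 = {7, 4, 6}"
  "nbrs k 6 = {4, 5, if 1 < k then 12 else 8}"
  "nbrs k 7 = {5, 4, if 1 < k then 13 else 11}"
proof -
  have eq: "nbrs k (8 * j + r) = nbrs_list k j ! r" if "r < 8" for j r
    using that by (simp add: nbrs_def)
  show "nbrs k (8 * j) = {8 * j + 2, 8 * j + 1, if j < k then 8 * j + 4 else 8 * j - 2}"
    using eq[of 0 j] by (simp add: nbrs_list_def)
  show "nbrs k (8 * j + 1) = {8 * j + 3, 8 * j, 8 * j + 2}"
    using eq[of 1 j] by (simp add: nbrs_list_def)
  show "nbrs k (8 * j + 2) = {8 * j, 8 * j + 1, 8 * j + 3}"
    using eq[of 2 j] by (simp add: nbrs_list_def)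
  show "nbrs k (8 * j + 3) = {8 * j + 1, 8 * j + 2, if j < k then 8 * j + 5 else 8 * j - 1}"
    using eq[of 3 j] by (simp add: nbrs_list_def)
  show "0 < j \<Longrightarrow> nbrs k (8 * j + 4) = {8 * j + 6, 8 * j, 8 * j - 2}"
    using eq[of 4 j] by (simp add: nbrs_list_def)
  show "0 < j \<Longrightarrow> nbrs k (8 * j + 5) = {8 * j + 7, 8 * j + 3, 8 * j - 1}"
    using eq[of 5 j] by (simp add: nbrs_list_def)
  show "0 < j \<Longrightarrow> nbrs k (8 * j + 6) =
     {8 * j + 4, 8 * j + 7, if j + 1 < k then 8 * j + 12 else 8 * j + 8}"
    using eq[of 6 j] by (simp add: nbrs_list_def)
  show "0 < j \<Longrightarrow> nbrs k (8 * j + 7) =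
     {8 * j + 5, 8 * j + 6, if j + 1 < k then 8 * j + 13 else 8 * j + 11}"
    using eq[of 7 j] by (simp add: nbrs_list_def)
  show "nbrs k 4 = {6, 5, 7}" "nbrs k 5 = {7, 4, 6}"
    "nbrs k 6 = {4, 5, if 1 < k then 12 else 8}" "nbrs k 7 = {5, 4, if 1 < k then 13 else 11}"
    using eq[of 4 0] eq[of 5 0] eq[of 6 0] eq[of 7 0] by (simp_all add: nbrs_list_def)
qed

lemma vertex_cases:
  fixes k v :: nat
  assumes "4 \<le> v" "v < 8 * k + 4"
  obtains "v \<in> {4, 5, 6, 7}" "0 < k"
    | j where "0 < j" "j < k" "v \<in> {8 * j + 4, 8 * j + 5, 8 * j + 6, 8 * j + 7}"
    | j where "0 < j" "j \<le> k" "v \<in> {8 * j, 8 * j + 1, 8 * j + 2, 8 * j + 3}"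
proof -
  obtain j i where v: "v = 8 * j + i" "i < 8"
    by (metis mod_less_divisor mult_div_mod_eq zero_less_numeral)
  then have "i \<in> {0, 1, 2, 3} \<or> i \<in> {4, 5, 6, 7}"
    by auto
  then show ?thesis
    using that assms v by (cases "j = 0") auto
qed

text \<open>Covers the shapes that simp produces: \<open>Suc\<close> terms for offsets 1 and 2, and
  vertices of index \<open>Suc j\<close> written over \<open>8 * j\<close>, as they arise when
  stepping up a rail.\<close>

lemma nbrs_shift:
  "nbrs k (Suc (8 * j)) = {8 * j + 3, 8 * j, 8 * j + 2}"
  "nbrs k (Suc (Suc (8 * j))) = {8 * j, 8 * j + 1, 8 * j + 3}"
  "nbrs k (8 * j + 8) = {8 * j + 10, 8 * j + 9, if Suc j < k then 8 * j + 12 else 8 * j + 6}"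
  "nbrs k (8 * j + 11) = {8 * j + 9, 8 * j + 10, if Suc j < k then 8 * j + 13 else 8 * j + 7}"
  "nbrs k (8 * j + 12) = {8 * j + 14, 8 * j + 8, 8 * j + 6}"
  "nbrs k (8 * j + 13) = {8 * j + 15, 8 * j + 11, 8 * j + 7}"
  using nbrs_simps(2,3)[of k j] nbrs_simps(1,4,5,6)[of "Suc j" k] nbrs_simps(1,4)[of k "Suc j"]
  by (simp_all add: add.commute)

lemma nbrs_in_verts:
  assumes "4 \<le> v" "v < 8 * k + 4" "w \<in> nbrs k v"
  shows "4 \<le> w \<and> w < 8 * k + 4"
proof (rule vertex_cases[OF assms(1,2)])
  assume "v \<in> {4, 5, 6, 7}" "0 < k"
  then show ?thesis using assms(3) by (auto split: if_splits)
next
  fix j assume "0 < j" "j < k" "v \<in> {8 * j + 4, 8 * j + 5, 8 * j + 6, 8 * j + 7}"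
  then show ?thesis using assms(3)
    by (auto split: if_splits)
next
  fix j assume "0 < j" "j \<le> k" "v \<in> {8 * j, 8 * j + 1, 8 * j + 2, 8 * j + 3}"
  then show ?thesis using assms(3)
    by (auto split: if_splits simp: nbrs_shift)
qed

text \<open>The upward edges at the rail vertices just below index \<open>j\<close>. Replacing
  \<open>j\<close> by \<open>Suc i\<close> removes the truncated subtraction, since
  \<open>8 * j - 2\<close> becomes \<open>8 * i + 6\<close>.\<close>

lemma nbrs_down:
  assumes "0 < j"
  shows "j < k \<Longrightarrow> 8 * j + 4 \<in> nbrs k (8 * j - 2)"
    and "j < k \<Longrightarrow> 8 * j + 5 \<in> nbrs k (8 * j - 1)"
    and "\<not> j < k \<Longrightarrow> 8 * j \<in> nbrs k (8 * j - 2)"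
    and "\<not> j < k \<Longrightarrow> 8 * j + 3 \<in> nbrs k (8 * j - 1)"
proof -
  obtain i where i: "j = Suc i"
    using assms gr0_implies_Suc by blast
  have up: "(if j < k then 8 * j + 4 else 8 * j) \<in> nbrs k (8 * i + 6)"
    "(if j < k then 8 * j + 5 else 8 * j + 3) \<in> nbrs k (8 * i + 7)"
    unfolding i by (cases "i = 0"; simp)+
  have "8 * i + 6 = 8 * j - 2" "8 * i + 7 = 8 * j - 1"
    using i by simp_all
  note up = up[unfolded this]
  show "j < k \<Longrightarrow> 8 * j + 4 \<in> nbrs k (8 * j - 2)"
    and "j < k \<Longrightarrow> 8 * j + 5 \<in> nbrs k (8 * j - 1)"
    and "\<not> j < k \<Longrightarrow> 8 * j \<in> nbrs k (8 * j - 2)"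
    and "\<not> j < k \<Longrightarrow> 8 * j + 3 \<in> nbrs k (8 * j - 1)"
    using up by (simp_all split: if_splits)
qed

lemma nbrs_sym:
  assumes "4 \<le> v" "v < 8 * k + 4" "w \<in> nbrs k v"
  shows "v \<in> nbrs k w"
proof (rule vertex_cases[OF assms(1,2)])
  assume "v \<in> {4, 5, 6, 7}" "0 < k"
  \<comment> \<open>The upward neighbours of 6 and 7 are 12 and 13, or 8 and 11 if
    \<open>k = 1\<close>; the instances at index 1 evaluate these numerals.\<close>
  then show ?thesis using assms(3) nbrs_simps(1,4)[of k 1] nbrs_simps(5,6)[of 1 k]
    by (elim insertE emptyE; simp split: if_splits; elim disjE; simp)
next
  fix j assume j: "0 < j" "j < k" and v: "v \<in> {8 * j + 4, 8 * j + 5, 8 * j + 6, 8 * j + 7}"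
  then show ?thesis using assms(3) nbrs_down[OF j(1), of k]
    by (elim insertE emptyE; simp split: if_splits; elim disjE; simp add: nbrs_shift)
next
  fix j assume j: "0 < j" "j \<le> k" and v: "v \<in> {8 * j, 8 * j + 1, 8 * j + 2, 8 * j + 3}"
  then show ?thesis using assms(3) nbrs_down[OF j(1), of k]
    by (elim insertE emptyE) (auto simp: nbrs_shift split: if_splits)
qed

lemma card_nbrs:
  assumes "4 \<le> v" "v < 8 * k + 4"
  shows "card (nbrs k v) = 3 \<and> v \<notin> nbrs k v"
proof (rule vertex_cases[OF assms])
  assume "v \<in> {4, 5, 6, 7}" "0 < k"
  then show ?thesis
    by (elim insertE emptyE; simp)
next
  fix j assume j: "0 < j" "j < k" and v: "v \<in> {8 * j + 4, 8 * j + 5, 8 * j + 6, 8 * j + 7}"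
  then show ?thesis
    by (elim insertE emptyE; simp)
next
  fix j assume j: "0 < j" "j \<le> k" and v: "v \<in> {8 * j, 8 * j + 1, 8 * j + 2, 8 * j + 3}"
  then show ?thesis
    by (elim insertE emptyE) (auto simp: nbrs_shift)
qed

lemma pair_graph_ladder: "pair_graph (ladder k)"
proof
  have "parcs (ladder k) \<subseteq> {4..<8 * k + 4} \<times> {4..<8 * k + 4}"
  proof
    fix e
    assume "e \<in> parcs (ladder k)"
    then show "e \<in> {4..<8 * k + 4} \<times> {4..<8 * k + 4}"
      using nbrs_in_verts[of "fst e" k "snd e"] by (cases e) simp
  qed
  then show "finite (parcs (ladder k))"
    by (rule finite_subset) simp
  show "symmetric (ladder k)"
    unfolding symmetric_def with_proj_simps
    using nbrs_in_verts nbrs_sym unfolding sym_def ladder_simps by blast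
  fix e
  assume "e \<in> parcs (ladder k)"
  then obtain v w where e: "e = (v, w)" "4 \<le> v" "v < 8 * k + 4" "w \<in> nbrs k v"
    by (cases e) auto
  then show "fst e \<in> pverts (ladder k)" "snd e \<in> pverts (ladder k)"
    using nbrs_in_verts[OF e(2-4)] by simp_all
  show "fst e \<noteq> snd e"
    using e card_nbrs by auto
qed simp

section \<open>Connectivity after deleting at most one vertex\<close>

text \<open>Reachability from \<open>u\<close> in the symmetric closure is itself an invariant along
  arcs, and it holds at \<open>u\<close>; if invariants are constant, it holds everywhere.
  Connectivity thus becomes propositional reasoning about two-colourings.\<close>

lemma connected_if_invariants_constant:
  fixes G :: "('a, 'b) pre_digraph"
  assumes "wf_digraph G" "verts G \<noteq> {}"
    and const: "\<And>(f :: 'a \<Rightarrow> bool) u w. (\<And>a. a \<in> arcs G \<Longrightarrow> f (tail G a) = f (head G a)) \<Longrightarrow>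
      u \<in> verts G \<Longrightarrow> w \<in> verts G \<Longrightarrow> f u = f w"
  shows "connected G"
proof -
  interpret wf_digraph G by (rule assms)
  interpret S: pair_sym_digraph "mk_symmetric G"
    using wellformed by unfold_locales
     (auto simp: mk_symmetric_def symmetric_def sym_def)
  have V: "pverts (mk_symmetric G) = verts G"
    by (simp add: mk_symmetric_def)
  have "reachable (mk_symmetric G) u w" if "u \<in> verts G" "w \<in> verts G" for u w
  proof -
    have "reachable (mk_symmetric G) u (tail G a) = reachable (mk_symmetric G) u (head G a)" if "a \<in> arcs G" for a
    proof -
      have "(tail G a, head G a) \<in> parcs (mk_symmetric G)" "(head G a, tail G a) \<in> parcs (mk_symmetric G)"
        using that by (auto simp: mk_symmetric_def)
      then show ?thesis
        by (metis S.reachable_adjI S.reachable_trans)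
    qed
    then have "reachable (mk_symmetric G) u u = reachable (mk_symmetric G) u w"
      by (rule const[OF _ that])
    then show ?thesis
      using that V by (simp add: S.reachable_refl)
  qed
  then show ?thesis
    using assms(2) V unfolding connected_def by (intro strongly_connectedI) simp_all
qed

text \<open>
  One block of the ladder above two rail vertices \<open>p\<close> and \<open>q\<close>, with a vertex \<open>x\<close> deleted: \<open>a0, \<dots>, a3\<close>
  is the diamond, \<open>a4, a6\<close> and \<open>a5, a7\<close> are the rails.
\<close>

lemma block_invariant_constant:
  fixes f :: "'a \<Rightarrow> bool"
  assumes "distinct [p, q, a0, a1, a2, a3, a4, a5, a6, a7]"
    and "p \<noteq> x \<Longrightarrow> f p = c" "q \<noteq> x \<Longrightarrow> f q = c"
    and "a0 \<noteq> x \<Longrightarrow> a1 \<noteq> x \<Longrightarrow> f a0 = f a1" "a0 \<noteq> x \<Longrightarrow> a2 \<noteq> x \<Longrightarrow> f a0 = f a2"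
      "a1 \<noteq> x \<Longrightarrow> a2 \<noteq> x \<Longrightarrow> f a1 = f a2" "a1 \<noteq> x \<Longrightarrow> a3 \<noteq> x \<Longrightarrow> f a1 = f a3"
      "a2 \<noteq> x \<Longrightarrow> a3 \<noteq> x \<Longrightarrow> f a2 = f a3" "a0 \<noteq> x \<Longrightarrow> a4 \<noteq> x \<Longrightarrow> f a0 = f a4"
      "a3 \<noteq> x \<Longrightarrow> a5 \<noteq> x \<Longrightarrow> f a3 = f a5" "a4 \<noteq> x \<Longrightarrow> a6 \<noteq> x \<Longrightarrow> f a4 = f a6"
      "a5 \<noteq> x \<Longrightarrow> a7 \<noteq> x \<Longrightarrow> f a5 = f a7" "a6 \<noteq> x \<Longrightarrow> a7 \<noteq> x \<Longrightarrow> f a6 = f a7"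
      "a4 \<noteq> x \<Longrightarrow> p \<noteq> x \<Longrightarrow> f a4 = f p" "a5 \<noteq> x \<Longrightarrow> q \<noteq> x \<Longrightarrow> f a5 = f q"
  shows "\<forall>a \<in> {a0, a1, a2, a3, a4, a5, a6, a7}. a \<noteq> x \<longrightarrow> f a = c"
  using assms unfolding distinct.simps list.set ball_simps insert_iff empty_iff by argo

text \<open>The analogue for the upper closing diamond. By distinctness \<open>x\<close> is at most
  one of the six vertices: a diamond without one vertex is still connected, and at least one of its
  two attachments survives.\<close>

lemma cap_invariant_constant:
  fixes f :: "'a \<Rightarrow> bool"
  assumes "distinct [p, q, a0, a1, a2, a3]"
    and "p \<noteq> x \<Longrightarrow> f p = c" "q \<noteq> x \<Longrightarrow> f q = c"
    and "a0 \<noteq> x \<Longrightarrow> a1 \<noteq> x \<Longrightarrow> f a0 = f a1" "a0 \<noteq> x \<Longrightarrow> a2 \<noteq> x \<Longrightarrow> f a0 = f a2"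
      "a1 \<noteq> x \<Longrightarrow> a2 \<noteq> x \<Longrightarrow> f a1 = f a2" "a1 \<noteq> x \<Longrightarrow> a3 \<noteq> x \<Longrightarrow> f a1 = f a3"
      "a2 \<noteq> x \<Longrightarrow> a3 \<noteq> x \<Longrightarrow> f a2 = f a3"
      "a0 \<noteq> x \<Longrightarrow> p \<noteq> x \<Longrightarrow> f a0 = f p" "a3 \<noteq> x \<Longrightarrow> q \<noteq> x \<Longrightarrow> f a3 = f q"
  shows "\<forall>a \<in> {a0, a1, a2, a3}. a \<noteq> x \<longrightarrow> f a = c"
  using assms unfolding distinct.simps list.set ball_simps insert_iff empty_iff by argo

text \<open>Serves both connectivity claims, as \<open>x = 0\<close> is no vertex and deletes
  nothing. The constant spreads upwards block by block, because a single deletion leaves one of the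
  two rails intact.\<close>

lemma ladder_invariant_constant:
  fixes f :: "nat \<Rightarrow> bool"
  assumes f: "\<And>u w. \<lbrakk>4 \<le> u; u < 8 * k + 4; w \<in> nbrs k u; u \<noteq> x; w \<noteq> x\<rbrakk> \<Longrightarrow> f u = f w"
    and k: "0 < k"
  obtains c where "\<And>v. \<lbrakk>4 \<le> v; v < 8 * k + 4; v \<noteq> x\<rbrakk> \<Longrightarrow> f v = c"
proof -
  \<comment> \<open>The value at a surviving vertex of the lower closing diamond that is adjacent to
    all the others there.\<close>
  define c where "c = (if x = 4 then f 5 else f 4)"
  \<comment> \<open>The bound \<open>8 * j + 8\<close> takes in all indices up to \<open>j\<close>;
    with \<open>j < k\<close> only the upper closing diamond is left for \<open>top\<close>.\<close>
  have below: "f v = c" if "j < k" "4 \<le> v" "v < 8 * j + 8" "v \<noteq> x" for j v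
    using that
  proof (induction j arbitrary: v)
    case 0
    then have "v \<in> {4, 5, 6, 7}"
      by auto
    moreover have "4 \<noteq> x \<Longrightarrow> 5 \<noteq> x \<Longrightarrow> f 4 = f 5" "4 \<noteq> x \<Longrightarrow> 6 \<noteq> x \<Longrightarrow> f 4 = f 6"
      "4 \<noteq> x \<Longrightarrow> 7 \<noteq> x \<Longrightarrow> f 4 = f 7" "5 \<noteq> x \<Longrightarrow> 6 \<noteq> x \<Longrightarrow> f 5 = f 6"
      "5 \<noteq> x \<Longrightarrow> 7 \<noteq> x \<Longrightarrow> f 5 = f 7"
      by (rule f; use k in simp)+
    ultimately show ?case
      using \<open>v \<noteq> x\<close> unfolding c_def by auto
  next
    case (Suc i)
    define j where "j = Suc i"
    have j: "0 < j" "j < k"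
      using Suc.prems by (simp_all add: j_def)
    have IH: "8 * j - 2 \<noteq> x \<Longrightarrow> f (8 * j - 2) = c" "8 * j - 1 \<noteq> x \<Longrightarrow> f (8 * j - 1) = c"
      using Suc.IH Suc.prems(1) by (auto simp: j_def)
    have e: "8 * j \<noteq> x \<Longrightarrow> 8 * j + 1 \<noteq> x \<Longrightarrow> f (8 * j) = f (8 * j + 1)"
      "8 * j \<noteq> x \<Longrightarrow> 8 * j + 2 \<noteq> x \<Longrightarrow> f (8 * j) = f (8 * j + 2)"
      "8 * j + 1 \<noteq> x \<Longrightarrow> 8 * j + 2 \<noteq> x \<Longrightarrow> f (8 * j + 1) = f (8 * j + 2)"
      "8 * j + 1 \<noteq> x \<Longrightarrow> 8 * j + 3 \<noteq> x \<Longrightarrow> f (8 * j + 1) = f (8 * j + 3)"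
      "8 * j + 2 \<noteq> x \<Longrightarrow> 8 * j + 3 \<noteq> x \<Longrightarrow> f (8 * j + 2) = f (8 * j + 3)"
      "8 * j \<noteq> x \<Longrightarrow> 8 * j + 4 \<noteq> x \<Longrightarrow> f (8 * j) = f (8 * j + 4)"
      "8 * j + 3 \<noteq> x \<Longrightarrow> 8 * j + 5 \<noteq> x \<Longrightarrow> f (8 * j + 3) = f (8 * j + 5)"
      "8 * j + 4 \<noteq> x \<Longrightarrow> 8 * j + 6 \<noteq> x \<Longrightarrow> f (8 * j + 4) = f (8 * j + 6)"
      "8 * j + 5 \<noteq> x \<Longrightarrow> 8 * j + 7 \<noteq> x \<Longrightarrow> f (8 * j + 5) = f (8 * j + 7)"
      "8 * j + 6 \<noteq> x \<Longrightarrow> 8 * j + 7 \<noteq> x \<Longrightarrow> f (8 * j + 6) = f (8 * j + 7)"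
      "8 * j + 4 \<noteq> x \<Longrightarrow> 8 * j - 2 \<noteq> x \<Longrightarrow> f (8 * j + 4) = f (8 * j - 2)"
      "8 * j + 5 \<noteq> x \<Longrightarrow> 8 * j - 1 \<noteq> x \<Longrightarrow> f (8 * j + 5) = f (8 * j - 1)"
      by (rule f; use j in \<open>simp add: nbrs_shift\<close>)+
    have "distinct [8 * j - 2, 8 * j - 1, 8 * j, 8 * j + 1, 8 * j + 2, 8 * j + 3,
        8 * j + 4, 8 * j + 5, 8 * j + 6, 8 * j + 7]"
      using j(1) by (simp; intro conjI; arith)
    from block_invariant_constant[where f = f and c = c and x = x, OF this IH e]
    have new: "\<forall>a \<in> {8 * j, 8 * j + 1, 8 * j + 2, 8 * j + 3, 8 * j + 4, 8 * j + 5, 8 * j + 6, 8 * j + 7}.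
        a \<noteq> x \<longrightarrow> f a = c" .
    show ?case
    proof (cases "v < 8 * j")
      case True
      then show ?thesis
        using Suc.IH[of v] Suc.prems by (simp add: j_def)
    next
      case False
      then have "v \<in> {8 * j, 8 * j + 1, 8 * j + 2, 8 * j + 3, 8 * j + 4, 8 * j + 5, 8 * j + 6, 8 * j + 7}"
        using Suc.prems(3) unfolding j_def insert_iff empty_iff by presburger
      then show ?thesis
        using new Suc.prems(4) by blast
    qed
  qed
  have top: "\<forall>a \<in> {8 * k, 8 * k + 1, 8 * k + 2, 8 * k + 3}. a \<noteq> x \<longrightarrow> f a = c"
  proof -
    have IH: "8 * k - 2 \<noteq> x \<Longrightarrow> f (8 * k - 2) = c" "8 * k - 1 \<noteq> x \<Longrightarrow> f (8 * k - 1) = c"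
      using below[of "k - 1"] k by (auto simp: diff_mult_distrib2)
    have e: "8 * k \<noteq> x \<Longrightarrow> 8 * k + 1 \<noteq> x \<Longrightarrow> f (8 * k) = f (8 * k + 1)"
      "8 * k \<noteq> x \<Longrightarrow> 8 * k + 2 \<noteq> x \<Longrightarrow> f (8 * k) = f (8 * k + 2)"
      "8 * k + 1 \<noteq> x \<Longrightarrow> 8 * k + 2 \<noteq> x \<Longrightarrow> f (8 * k + 1) = f (8 * k + 2)"
      "8 * k + 1 \<noteq> x \<Longrightarrow> 8 * k + 3 \<noteq> x \<Longrightarrow> f (8 * k + 1) = f (8 * k + 3)"
      "8 * k + 2 \<noteq> x \<Longrightarrow> 8 * k + 3 \<noteq> x \<Longrightarrow> f (8 * k + 2) = f (8 * k + 3)"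
      "8 * k \<noteq> x \<Longrightarrow> 8 * k - 2 \<noteq> x \<Longrightarrow> f (8 * k) = f (8 * k - 2)"
      "8 * k + 3 \<noteq> x \<Longrightarrow> 8 * k - 1 \<noteq> x \<Longrightarrow> f (8 * k + 3) = f (8 * k - 1)"
      by (rule f; use k in \<open>simp add: nbrs_shift\<close>)+
    have "distinct [8 * k - 2, 8 * k - 1, 8 * k, 8 * k + 1, 8 * k + 2, 8 * k + 3]"
      using k by (simp; intro conjI; arith)
    from cap_invariant_constant[where f = f and c = c and x = x, OF this IH e]
    show ?thesis .
  qed
  show ?thesis
  proof (rule that)
    fix v assume v: "4 \<le> v" "v < 8 * k + 4" "v \<noteq> x"
    show "f v = c"
    proof (cases "v < 8 * k")
      case True
      then show ?thesis
        using below[of "k - 1" v] v k by (simp add: diff_mult_distrib2)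
    next
      case False
      then have "v \<in> {8 * k, 8 * k + 1, 8 * k + 2, 8 * k + 3}"
        using v(2) unfolding insert_iff empty_iff by presburger
      then show ?thesis
        using top v(3) by blast
    qed
  qed
qed

lemma connected_ladder:
  assumes "0 < k"
  shows "connected (ladder k)"
proof (rule connected_if_invariants_constant)
  interpret pair_graph "ladder k" by (rule pair_graph_ladder)
  show "wf_digraph (ladder k)" ..
  fix f :: "nat \<Rightarrow> bool" and u w
  assume "\<And>a. a \<in> arcs (ladder k) \<Longrightarrow> f (tail (ladder k) a) = f (head (ladder k) a)"
  then have "f u = f w" if "4 \<le> u" "u < 8 * k + 4" "w \<in> nbrs k u" for u w
    using that by (force simp: ladder_def)
  then obtain c where "\<And>v. \<lbrakk>4 \<le> v; v < 8 * k + 4; v \<noteq> 0\<rbrakk> \<Longrightarrow> f v = c"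
    using ladder_invariant_constant[of k 0 f] assms by metis
  moreover assume "u \<in> verts (ladder k)" "w \<in> verts (ladder k)"
  ultimately show "f u = f w" by simp
qed (use assms in simp)

lemma connected_del_vert_ladder:
  assumes "0 < k"
  shows "connected (pre_digraph.del_vert (ladder k) x)"
proof (rule connected_if_invariants_constant)
  interpret pair_graph "ladder k" by (rule pair_graph_ladder)
  let ?G = "pre_digraph.del_vert (ladder k) x"
  show "wf_digraph ?G" by (rule wf_digraph_del_vert)
  have "4 \<in> verts ?G \<or> 5 \<in> verts ?G"
    using assms by (auto simp: verts_del_vert)
  then show "verts ?G \<noteq> {}" by blast
  fix f :: "nat \<Rightarrow> bool" and u w
  assume f: "\<And>a. a \<in> arcs ?G \<Longrightarrow> f (tail ?G a) = f (head ?G a)"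
  have "f u = f w" if "4 \<le> u" "u < 8 * k + 4" "w \<in> nbrs k u" "u \<noteq> x" "w \<noteq> x" for u w
    using f[of "(u, w)"] that by (simp add: del_vert_simps)
  then obtain c where "\<And>v. \<lbrakk>4 \<le> v; v < 8 * k + 4; v \<noteq> x\<rbrakk> \<Longrightarrow> f v = c"
    using ladder_invariant_constant[of k x f] assms by metis
  moreover assume "u \<in> verts ?G" "w \<in> verts ?G"
  ultimately show "f u = f w" by (simp add: verts_del_vert)
qed

lemma two_connected_ladder:
  assumes "0 < k"
  shows "two_connected (ladder k)"
  using assms by (simp add: two_connected_def connected_ladder connected_del_vert_ladder)

section \<open>Degrees\<close>

lemma out_degree_conv_card_arcs:
  fixes F :: "'a pair_pre_digraph"
  shows "out_degree F v = card {w. (v, w) \<in> parcs F}"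
proof -
  have "out_arcs F v = Pair v ` {w. (v, w) \<in> parcs F}"
    by (auto simp: out_arcs_def)
  then show ?thesis
    by (simp add: out_degree_def card_image inj_on_def)
qed

lemma cubic_ladder: "cubic (ladder k)"
  using card_nbrs by (simp add: cubic_def out_degree_conv_card_arcs)

section \<open>Lower bound on the excess\<close>

text \<open>
  A set \<open>C\<close> closed under adjacency contains the component of \<open>v\<close>, so the second alternative provides a
  nontrivial component whose lowest level is \<open>j\<close>; for different \<open>j\<close> these components are different.
\<close>

lemma (in pair_graph) exc_ge_of_levels:
  fixes lev :: "'a \<Rightarrow> nat"
  assumes "\<And>j. j < k \<Longrightarrow>
      (\<exists>u v. u \<noteq> v \<and> u \<in> pverts G \<and> v \<in> pverts G \<and> lev u = j \<and> lev v = j \<and>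
        (\<forall>w. (u, w) \<notin> parcs G) \<and> (\<forall>w. (v, w) \<notin> parcs G)) \<or>
      (\<exists>C v w. v \<in> C \<and> (v, w) \<in> parcs G \<and> lev v = j \<and> (\<forall>u \<in> C. j \<le> lev u) \<and>
        (\<forall>a b. a \<in> C \<longrightarrow> (a, b) \<in> parcs G \<longrightarrow> b \<in> C))"
    (is "\<And>j. j < k \<Longrightarrow> ?iso j \<or> ?comp j")
  shows "2 * k \<le> exc G"
proof -
  define I where "I = {v \<in> pverts G. \<forall>w. (v, w) \<notin> parcs G}"
  \<comment> \<open>Without finiteness, \<open>card\<close> equal to 0 would not mean that the
    vertex is isolated.\<close>
  have fin: "finite {w. (v, w) \<in> parcs G}" for v
    using pair_finite_arcs by (rule finite_subset[rotated, OF finite_imageI[of _ snd]]) force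
  have iso: "num_isolated G = card I"
    using fin by (auto simp: num_isolated_def I_def out_degree_conv_card_arcs intro!: arg_cong[where f = card])
  have finI: "finite I"
    using pair_finite_verts by (simp add: I_def)
  \<comment> \<open>Each level is charged once: those in \<open>A\<close> to two isolated vertices
    of that level, those in \<open>B\<close> to a nontrivial component, which weighs 2 in
    \<open>exc\<close>.\<close>
  define A where "A = {j \<in> {..<k}. ?iso j}"
  define B where "B = {j \<in> {..<k}. \<not> ?iso j}"
  have "A \<inter> B = {}" "A \<union> B = {..<k}" "finite A" "finite B"
    by (auto simp: A_def B_def)
  then have k: "k = card A + card B"
    by (metis card_Un_disjoint card_lessThan)
  have "2 * card A = (\<Sum>j \<in> A. 2)"
    by simp
  also have "\<dots> \<le> (\<Sum>j \<in> A. card {v \<in> I. lev v = j})"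
  proof (rule sum_mono)
    fix j assume "j \<in> A"
    then obtain u v where "u \<noteq> v" "{u, v} \<subseteq> {v \<in> I. lev v = j}"
      by (auto simp: A_def I_def)
    then show "2 \<le> card {v \<in> I. lev v = j}"
      using card_mono[of "{v \<in> I. lev v = j}" "{u, v}"] finI by simp
  qed
  also have "\<dots> = card (\<Union>j \<in> A. {v \<in> I. lev v = j})"
    by (rule card_UN_disjoint[symmetric]) (use \<open>finite A\<close> finI in auto)
  also have "\<dots> \<le> card I"
    by (rule card_mono) (use finI in auto)
  finally have A: "2 * card A \<le> num_isolated G"
    by (simp add: iso)
  have "\<exists>S. S \<in> {S \<in> sccs_verts. 2 \<le> card S} \<and> j \<in> lev ` S \<and> (\<forall>u \<in> S. j \<le> lev u)" if j: "j \<in> B" for j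
  proof -
    obtain C v w where C: "v \<in> C" "(v, w) \<in> parcs G" "lev v = j" "\<And>u. u \<in> C \<Longrightarrow> j \<le> lev u"
      "\<And>a b. a \<in> C \<Longrightarrow> (a, b) \<in> parcs G \<Longrightarrow> b \<in> C"
      using assms[of j] j unfolding B_def by blast
    have V: "v \<in> pverts G" "w \<in> pverts G"
      using C(2) by (auto dest: in_arcsD1 in_arcsD2)
    have closed: "u \<in> C" if "reachable G v u" for u
      using that by (induction rule: reachable_induct) (use C in auto)
    have "w \<in> scc_of v"
      using C(2) by (intro scc_ofI_reachable') auto
    moreover have "v \<in> scc_of v"
      using V by (simp add: in_scc_of_self)
    moreover have "scc_of v \<in> sccs_verts"
      using V by (intro scc_of_in_sccs_verts) simp
    moreover have "v \<noteq> w"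
      using C(2) pair_no_loops by fastforce
    moreover have "finite (scc_of v)"
      using sccs_verts_subsets[of "scc_of v"] calculation(3) pair_finite_verts by (auto intro: finite_subset)
    ultimately have "scc_of v \<in> {S \<in> sccs_verts. 2 \<le> card S}"
      using card_mono[of "scc_of v" "{v, w}"] by simp
    moreover have "\<forall>u \<in> scc_of v. j \<le> lev u"
      using closed C(4) by (auto simp: scc_of_def)
    ultimately show ?thesis
      using \<open>v \<in> scc_of v\<close> C(3) by blast
  qed
  then obtain S where S: "\<And>j. j \<in> B \<Longrightarrow> S j \<in> {S \<in> sccs_verts. 2 \<le> card S}"
    "\<And>j. j \<in> B \<Longrightarrow> j \<in> lev ` S j" "\<And>j u. j \<in> B \<Longrightarrow> u \<in> S j \<Longrightarrow> j \<le> lev u"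
    by metis
  have "inj_on S B"
    by (rule inj_onI) (metis S(2,3) imageE le_antisym)
  moreover have "finite {S \<in> sccs_verts. 2 \<le> card S}"
    using finite_sccs_verts by simp
  ultimately have "card B \<le> num_nontrivial_components G"
    unfolding num_nontrivial_components_def using S(1) by (intro card_inj_on_le[of S]) auto
  with A k show ?thesis
    by (simp add: exc_def)
qed

text \<open>An even degree at a cubic vertex means that the exclusive or of the three edge
  indicators is false. In this form parity arguments become propositional.\<close>

lemma even_card_triple:
  assumes "even (card {w. P w})" "\<And>w. P w \<Longrightarrow> w \<in> {x, y, z}" "distinct [x, y, z]"
  shows "P x \<longleftrightarrow> (P y \<noteq> P z)"
proof -
  have "{w. P w} = (if P x then {x} else {}) \<union> (if P y then {y} else {}) \<union> (if P z then {z} else {})"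
    using assms(2) by auto
  then show ?thesis
    using assms(1,3) by (auto split: if_splits)
qed

text \<open>The two rails form the 2-edge cut below the diamond rung. A neighbour of a vertex of
  index \<open>i\<close> is at least \<open>8 * i - 2\<close>, so an edge that crosses
  \<open>8 * j\<close> downwards starts at index \<open>j\<close>.\<close>

lemma nbrs_cut_below_rung:
  assumes "4 \<le> a" "a < 8 * k + 4" "b \<in> nbrs k a" "8 * j \<le> a" "b < 8 * j" "0 < j" "j < k"
  shows "a = 8 * j + 4 \<and> b = 8 * j - 2 \<or> a = 8 * j + 5 \<and> b = 8 * j - 1"
proof (rule vertex_cases[OF assms(1,2)])
  assume "a \<in> {4, 5, 6, 7}"
  then show ?thesis using assms by auto
next
  fix i assume i: "0 < i" "i < k" "a \<in> {8 * i + 4, 8 * i + 5, 8 * i + 6, 8 * i + 7}"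
  then have "a \<le> 8 * i + 7" "8 * i \<le> b + 2"
    using assms(3) by (auto split: if_splits)
  then have "i = j"
    using assms(4,5) by linarith
  then show ?thesis
    using i assms(3-) by (auto split: if_splits)
next
  fix i assume i: "0 < i" "i \<le> k" "a \<in> {8 * i, 8 * i + 1, 8 * i + 2, 8 * i + 3}"
  then have "a \<le> 8 * i + 3" "8 * i \<le> b + 2"
    using assms(3) by (auto simp: nbrs_shift split: if_splits)
  then have "i = j"
    using assms(4,5) by linarith
  then show ?thesis
    using i assms(3-) by (auto simp: nbrs_shift split: if_splits)
qed

text \<open>The second 2-edge cut of a level, between its diamond rung and its edge rung.\<close>

lemma nbrs_cut_above_rung:
  assumes "4 \<le> a" "a < 8 * k + 4" "b \<in> nbrs k a" "8 * j + 6 \<le> a" "b < 8 * j + 6" "0 < j" "j < k"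
  shows "a = 8 * j + 6 \<and> b = 8 * j + 4 \<or> a = 8 * j + 7 \<and> b = 8 * j + 5"
proof (rule vertex_cases[OF assms(1,2)])
  assume "a \<in> {4, 5, 6, 7}"
  then show ?thesis using assms by auto
next
  fix i assume i: "0 < i" "i < k" "a \<in> {8 * i + 4, 8 * i + 5, 8 * i + 6, 8 * i + 7}"
  then have "a \<le> 8 * i + 7" "8 * i \<le> b + 2"
    using assms(3) by (auto split: if_splits)
  then have "i = j"
    using assms(4,5) by linarith
  then show ?thesis
    using i assms(3-) by (auto split: if_splits)
next
  fix i assume i: "0 < i" "i \<le> k" "a \<in> {8 * i, 8 * i + 1, 8 * i + 2, 8 * i + 3}"
  then have "a \<le> 8 * i + 3" "8 * i \<le> b + 2"
    using assms(3) by (auto simp: nbrs_shift split: if_splits)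
  then have "i = j"
    using assms(4,5) by linarith
  then show ?thesis
    using i assms(3-) by (auto simp: nbrs_shift split: if_splits)
qed

text \<open>Levels are given by \<open>v div 8\<close>: level 0 is the lower closing diamond, and
  the upper one has index \<open>k\<close>, which is not counted.\<close>

lemma exc_ge_ladder:
  assumes F: "F \<in> spanning_eulerian_subgraphs (ladder k)" and k: "0 < k"
  shows "2 * k \<le> exc F"
proof -
  have "pair_graph F"
    using F by (simp add: spanning_eulerian_subgraphs_def)
  then interpret F: pair_graph F .
  have verts: "pverts F = {4..<8 * k + 4}" and "parcs F \<subseteq> parcs (ladder k)"
    using F by (auto simp: spanning_eulerian_subgraphs_def spanning_def subgraph_def)
  then have arcs: "4 \<le> u \<and> u < 8 * k + 4 \<and> w \<in> nbrs k u" if "(u, w) \<in> parcs F" for u w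
    using that ladder_simps(2) by blast
  define e where "e u w \<longleftrightarrow> (u, w) \<in> parcs F" for u w
  have sym: "e u w = e w u" for u w
    unfolding e_def using F.arcs_symmetric by blast
  have par: "e v x \<longleftrightarrow> (e v y \<noteq> e v z)" if "nbrs k v = {x, y, z}" "4 \<le> v" "v < 8 * k + 4" for v x y z
  proof (rule even_card_triple[where P = "e v"])
    show "even (card {w. e v w})"
      using F that verts by (simp add: spanning_eulerian_subgraphs_def eulerian_def e_def out_degree_conv_card_arcs)
    show "e v w \<Longrightarrow> w \<in> {x, y, z}" for w
      using arcs[of v w] that by (simp add: e_def)
    show "distinct [x, y, z]"
      using card_nbrs[of v k] that by (auto simp: card_insert_if split: if_splits)
  qed
  have block: "e (8 * j + 2) (8 * j) \<longleftrightarrow> (e (8 * j + 2) (8 * j + 1) \<noteq> e (8 * j + 2) (8 * j + 3))"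
    "e (8 * j + 1) (8 * j + 3) \<longleftrightarrow> (e (8 * j + 1) (8 * j) \<noteq> e (8 * j + 1) (8 * j + 2))"
    "e (8 * j) (8 * j + 2) \<longleftrightarrow> (e (8 * j) (8 * j + 1) \<noteq> e (8 * j) (8 * j + 4))"
    "e (8 * j + 3) (8 * j + 1) \<longleftrightarrow> (e (8 * j + 3) (8 * j + 2) \<noteq> e (8 * j + 3) (8 * j + 5))"
    "e (8 * j + 4) (8 * j + 6) \<longleftrightarrow> (e (8 * j + 4) (8 * j) \<noteq> e (8 * j + 4) (8 * j - 2))"
    "e (8 * j + 5) (8 * j + 7) \<longleftrightarrow> (e (8 * j + 5) (8 * j + 3) \<noteq> e (8 * j + 5) (8 * j - 1))"
    if "0 < j" "j < k" for j
    by (rule par; use that in \<open>simp add: nbrs_shift\<close>)+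
  have upper: "e (8 * j + 6) (8 * j + 4) \<longleftrightarrow> (e (8 * j + 6) (8 * j + 7) \<noteq> e (8 * j + 6) (if j + 1 < k then 8 * j + 12 else 8 * j + 8))"
    "e (8 * j + 7) (8 * j + 5) \<longleftrightarrow> (e (8 * j + 7) (8 * j + 6) \<noteq> e (8 * j + 7) (if j + 1 < k then 8 * j + 13 else 8 * j + 11))"
    if "0 < j" "j < k" for j
    by (rule par; use that in \<open>simp\<close>)+
  have bottom: "e 4 6 \<longleftrightarrow> (e 4 5 \<noteq> e 4 7)" "e 5 7 \<longleftrightarrow> (e 5 4 \<noteq> e 5 6)"
    "1 < k \<Longrightarrow> e 6 4 \<longleftrightarrow> (e 6 5 \<noteq> e 6 12)" "1 < k \<Longrightarrow> e 7 5 \<longleftrightarrow> (e 7 4 \<noteq> e 7 13)"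
    by (rule par; use k in simp)+
  \<comment> \<open>Adding the parities at the four diamond vertices cancels the inner edges and
    leaves the two outer ones.\<close>
  have rung: "e (8 * j) (8 * j + 4) = e (8 * j + 3) (8 * j + 5)" if "0 < j" "j < k" for j
    using block(1-4)[OF that] sym[of "8 * j" "8 * j + 1"] sym[of "8 * j" "8 * j + 2"]
      sym[of "8 * j + 1" "8 * j + 2"] sym[of "8 * j + 1" "8 * j + 3"] sym[of "8 * j + 2" "8 * j + 3"]
    by argo
  \<comment> \<open>The same cancellation, carried upwards level by level: both edges of the cut
    below a rung are present, or neither.\<close>
  have rails: "e (8 * j + 4) (8 * j - 2) = e (8 * j + 5) (8 * j - 1)" if "0 < j" "j < k" for j
    using that
  proof (induction j)
    case (Suc i)
    show ?case
    proof (cases "i = 0")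
      case True
      then show ?thesis
        using bottom Suc.prems sym[of 4] sym[of 5 6] sym[of 5 7] sym[of 6 12] sym[of 7 13] by auto
    next
      case False
      then have i: "0 < i" "i < k"
        using Suc.prems by simp_all
      have "e (8 * i + 6) (8 * i + 4) \<longleftrightarrow> (e (8 * i + 6) (8 * i + 7) \<noteq> e (8 * i + 6) (8 * i + 12))"
        "e (8 * i + 7) (8 * i + 5) \<longleftrightarrow> (e (8 * i + 7) (8 * i + 6) \<noteq> e (8 * i + 7) (8 * i + 13))"
        using upper[OF i] Suc.prems(2) by simp_all
      then have "e (8 * i + 12) (8 * i + 6) = e (8 * i + 13) (8 * i + 7)"
        using Suc.IH[OF i] block(5,6)[OF i] rung[OF i]
          sym[of "8 * i + 4" "8 * i"] sym[of "8 * i + 5" "8 * i + 3"]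
          sym[of "8 * i + 6" "8 * i + 4"] sym[of "8 * i + 6" "8 * i + 7"]
          sym[of "8 * i + 7" "8 * i + 5"] sym[of "8 * i + 6" "8 * i + 12"] sym[of "8 * i + 7" "8 * i + 13"]
        by argo
      then show ?thesis
        by (simp add: add.commute)
    qed
  qed simp
  show ?thesis
  proof (rule F.exc_ge_of_levels[where lev = "\<lambda>v. v div 8"])
    fix j
    assume "j < k"
    show "(\<exists>u v. u \<noteq> v \<and> u \<in> pverts F \<and> v \<in> pverts F \<and> u div 8 = j \<and> v div 8 = j \<and>
        (\<forall>w. (u, w) \<notin> parcs F) \<and> (\<forall>w. (v, w) \<notin> parcs F)) \<or>
      (\<exists>C v w. v \<in> C \<and> (v, w) \<in> parcs F \<and> v div 8 = j \<and> (\<forall>u \<in> C. j \<le> u div 8) \<and>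
        (\<forall>a b. a \<in> C \<longrightarrow> (a, b) \<in> parcs F \<longrightarrow> b \<in> C))"
      (is "?iso \<or> ?comp")
    proof (rule disjCI)
      assume no_comp: "\<not> ?comp"
      \<comment> \<open>An edge at such a \<open>v\<close> would make \<open>C\<close> a witness for
        \<open>?comp\<close>. Each case below therefore only needs a set that is closed under
        \<open>e\<close> and has no vertex below level \<open>j\<close>.\<close>
      have iso: "\<forall>w. (v, w) \<notin> parcs F"
        if "v \<in> C" "v div 8 = j" "C \<subseteq> {8 * j..}" "\<And>a b. a \<in> C \<Longrightarrow> e a b \<Longrightarrow> b \<in> C" for v C
      proof -
        have "\<forall>u \<in> C. j \<le> u div 8"
          using that(3) by auto
        then show ?thesis
          using no_comp that(1,2,4) unfolding e_def by blast
      qed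
      have pair: ?iso
        if "u \<noteq> v" "u div 8 = j" "v div 8 = j" "4 \<le> u" "4 \<le> v" "u < 8 * k + 4" "v < 8 * k + 4"
          "u \<in> C" "v \<in> C" "C \<subseteq> {8 * j..}" "\<And>a b. a \<in> C \<Longrightarrow> e a b \<Longrightarrow> b \<in> C" for u v C
      proof -
        have "\<forall>w. (u, w) \<notin> parcs F" "\<forall>w. (v, w) \<notin> parcs F"
          by (rule iso[OF that(8,2,10,11)], assumption+) (rule iso[OF that(9,3,10,11)], assumption+)
        then show ?thesis
          using that(1-7) verts by auto
      qed
      show ?iso
      proof (cases "j = 0")
        case True
        then show ?thesis
          using k by (intro pair[of 4 5 UNIV]) auto
      next
        case False
        then have j: "0 < j" "j < k"
          using \<open>j < k\<close> by simp_all
        consider "\<not> e (8 * j) (8 * j + 4)"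
          | "e (8 * j) (8 * j + 4)" "\<not> e (8 * j + 4) (8 * j - 2)"
          | "e (8 * j) (8 * j + 4)" "e (8 * j + 4) (8 * j - 2)"
          by blast
        then show ?thesis
        proof cases
          case 1
          have "b \<in> {8 * j, 8 * j + 1, 8 * j + 2, 8 * j + 3}"
            if "a \<in> {8 * j, 8 * j + 1, 8 * j + 2, 8 * j + 3}" "e a b" for a b
            using arcs[of a b] that 1 rung[OF j] j by (auto simp: e_def nbrs_shift)
          then show ?thesis
            using j by (intro pair[of "8 * j" "8 * j + 1" "{8 * j, 8 * j + 1, 8 * j + 2, 8 * j + 3}"]) auto
        next
          \<comment> \<open>By the cut below the rung, \<open>{8 * j..}\<close> is closed. Then
            \<open>8 * j + 4\<close> would be isolated, contrary to its edge to
            \<open>8 * j\<close>.\<close>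
          case 2
          have "b \<in> {8 * j..}" if "a \<in> {8 * j..}" "e a b" for a b
            using nbrs_cut_below_rung[of a k b j] arcs[of a b] that 2 rails[OF j] j
            by (cases "b < 8 * j") (auto simp: e_def)
          then have "\<forall>w. (8 * j + 4, w) \<notin> parcs F"
            by (intro iso[of _ "{8 * j..}"]) auto
          then show ?thesis
            using 2(1) sym by (auto simp: e_def)
        next
          \<comment> \<open>Each of \<open>8 * j + 4\<close> and \<open>8 * j + 5\<close> already
            has degree two, so no edge crosses to the edge rung and everything from
            \<open>8 * j + 6\<close> on is closed.\<close>
          case 3
          then have "\<not> e (8 * j + 6) (8 * j + 4)" "\<not> e (8 * j + 7) (8 * j + 5)"
            using block(5,6)[OF j] rung[OF j] rails[OF j] sym by blast+
          then have "b \<in> {8 * j + 6..}" if "a \<in> {8 * j + 6..}" "e a b" for a b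
            using nbrs_cut_above_rung[of a k b j] arcs[of a b] that j
            by (cases "b < 8 * j + 6") (auto simp: e_def)
          then show ?thesis
            using j by (intro pair[of "8 * j + 6" "8 * j + 7" "{8 * j + 6..}"]) auto
        qed
      qed
    qed
  qed
qed

section \<open>Upper bound from a 2-factor\<close>

text \<open>Deleting this perfect matching from the ladder leaves \<open>k\<close> cycles.\<close>

definition partner :: "nat \<Rightarrow> nat" where
  "partner v = (if v mod 4 < 2 then v + 2 else v - 2)"

lemma partner_simps [simp]:
  "partner (8 * j) = 8 * j + 2" "partner (8 * j + 1) = 8 * j + 3"
  "partner (Suc (8 * j)) = 8 * j + 3" "partner (Suc (Suc (8 * j))) = 8 * j"
  "partner (8 * j + 2) = 8 * j" "partner (8 * j + 3) = 8 * j + 1"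
  "partner (8 * j + 4) = 8 * j + 6" "partner (8 * j + 5) = 8 * j + 7"
  "partner (8 * j + 6) = 8 * j + 4" "partner (8 * j + 7) = 8 * j + 5"
  "partner 4 = 6" "partner 5 = 7" "partner 6 = 4" "partner 7 = 5"
  unfolding partner_def by presburger+

text \<open>In each block \<open>4 * q, ..., 4 * q + 3\<close> the map swaps residues
  \<open>r\<close> and \<open>r + 2\<close>. Being an involution, it leaves the arcs of
  \<open>two_factor\<close> symmetric.\<close>

lemma partner_partner: "partner (partner v) = v"
proof -
  have eq: "partner (4 * q + r) = 4 * q + (if r < 2 then r + 2 else r - 2)" if "r < 4" for q r
    using that by (simp add: partner_def)
  have "partner (partner (4 * q + r)) = 4 * q + r" if "r < 4" for q r
  proof -
    have "r < 2 \<and> r + 2 < 4 \<or> \<not> r < 2 \<and> r - 2 < 2"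
      using that by arith
    then show ?thesis
      using that eq[of r q] eq[of "r + 2" q] eq[of "r - 2" q] by auto
  qed
  from this[of "v mod 4" "v div 4"] show ?thesis
    by simp
qed

lemma partner_in_nbrs:
  assumes "4 \<le> v" "v < 8 * k + 4"
  shows "partner v \<in> nbrs k v"
proof (rule vertex_cases[OF assms])
  assume "v \<in> {4, 5, 6, 7}"
  then show ?thesis by auto
next
  fix j assume "0 < j" "j < k" "v \<in> {8 * j + 4, 8 * j + 5, 8 * j + 6, 8 * j + 7}"
  then show ?thesis by auto
next
  fix j assume "0 < j" "j \<le> k" "v \<in> {8 * j, 8 * j + 1, 8 * j + 2, 8 * j + 3}"
  then show ?thesis by (auto simp: nbrs_shift)
qed

definition two_factor :: "nat \<Rightarrow> nat pair_pre_digraph" where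
  "two_factor k = \<lparr>pverts = {4..<8 * k + 4},
     parcs = {(u, w). (u, w) \<in> parcs (ladder k) \<and> w \<noteq> partner u}\<rparr>"

lemma two_factor_simps [simp]:
  "pverts (two_factor k) = {4..<8 * k + 4}"
  "(u, w) \<in> parcs (two_factor k) \<longleftrightarrow> (u, w) \<in> parcs (ladder k) \<and> w \<noteq> partner u"
  by (simp_all add: two_factor_def del: ladder_simps)

lemma pair_graph_two_factor: "pair_graph (two_factor k)"
proof -
  interpret pair_graph "ladder k" by (rule pair_graph_ladder)
  have sub: "parcs (two_factor k) \<subseteq> parcs (ladder k)"
    by (auto simp: two_factor_def)
  show ?thesis
  proof
    show "finite (parcs (two_factor k))"
      using sub pair_finite_arcs by (rule finite_subset)
    show "symmetric (two_factor k)"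
      unfolding symmetric_def with_proj_simps sym_def two_factor_simps
      using arcs_symmetric partner_partner by metis
    fix e
    assume "e \<in> parcs (two_factor k)"
    then have "e \<in> parcs (ladder k)"
      using sub by blast
    then show "fst e \<in> pverts (two_factor k)" "snd e \<in> pverts (two_factor k)" "fst e \<noteq> snd e"
      using arc_fst_in_verts[of e] arc_snd_in_verts[of e] pair_no_loops[of e] by simp_all
  qed simp
qed

lemma out_degree_two_factor:
  assumes "4 \<le> v" "v < 8 * k + 4"
  shows "out_degree (two_factor k) v = 2"
proof -
  have "{w. (v, w) \<in> parcs (two_factor k)} = nbrs k v - {partner v}"
    using assms by auto
  moreover have "card (nbrs k v - {partner v}) = 2"
    using card_nbrs[OF assms] partner_in_nbrs[OF assms] by simp
  ultimately show ?thesis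
    by (simp add: out_degree_conv_card_arcs)
qed

lemma two_factor_spanning_eulerian: "two_factor k \<in> spanning_eulerian_subgraphs (ladder k)"
proof -
  interpret pair_graph "ladder k" by (rule pair_graph_ladder)
  interpret H: pair_graph "two_factor k" by (rule pair_graph_two_factor)
  have "spanning (two_factor k) (ladder k)"
    using wf_digraph_axioms H.wf_digraph_axioms
    by (auto simp: spanning_def subgraph_def two_factor_def)
  then show ?thesis
    using pair_graph_two_factor by (simp add: spanning_eulerian_subgraphs_def eulerian_def out_degree_two_factor)
qed

text \<open>For \<open>j < k\<close>, cycle \<open>j\<close> takes the edge rung
  \<open>8 * j + 6\<close>, \<open>8 * j + 7\<close> (for \<open>j = 0\<close> the path 6, 5, 4, 7),
  follows both rails up and closes along a Hamiltonian path of diamond \<open>j + 1\<close>. So the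
  vertices \<open>8 * j + 6\<close> represent all components, and no vertex is isolated.\<close>

lemma exc_two_factor_le:
  assumes k: "0 < k"
  shows "exc (two_factor k) \<le> 2 * k"
proof -
  interpret pair_graph "two_factor k" by (rule pair_graph_two_factor)
  have s: "scc_of u = scc_of w" if "4 \<le> u" "u < 8 * k + 4" "w \<in> nbrs k u" "w \<noteq> partner u" for u w
  proof -
    have "(u, w) \<in> parcs (two_factor k)"
      using that by simp
    then have "reachable (two_factor k) u w" "reachable (two_factor k) w u"
      using arcs_symmetric by (blast intro: reachable_adjI)+
    then show ?thesis
      unfolding scc_of_def using reachable_trans by blast
  qed
  have base: "scc_of 5 = scc_of 6" "scc_of 5 = scc_of 4" "scc_of 4 = scc_of 7"
    by (rule s; use k in simp)+
  have mid: "scc_of (8 * j + 6) = scc_of (8 * j + 7)" if "0 < j" "j < k" for j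
    by (rule s; use that in simp)
  have path: "scc_of (8 * j) = scc_of (8 * j + 1)" "scc_of (8 * j + 1) = scc_of (8 * j + 2)"
     "scc_of (8 * j + 2) = scc_of (8 * j + 3)" if "0 < j" "j \<le> k" for j
    by (rule s; use that in \<open>simp add: nbrs_shift\<close>)+
  have rung: "scc_of (8 * j) = scc_of (8 * j + 4)" "scc_of (8 * j + 3) = scc_of (8 * j + 5)"
     "scc_of (8 * j + 4) = scc_of (8 * j - 2)" if "0 < j" "j < k" for j
    by (rule s; use that in simp)+
  have top: "scc_of (8 * k) = scc_of (8 * k - 2)"
    by (rule s; use k in simp)
  have diamond: "scc_of (8 * j) = scc_of (8 * j - 2)" if "0 < j" "j \<le> k" for j
    using that rung[of j] top by (cases "j = k") simp_all
  \<comment> \<open>Diamond \<open>j\<close> lies on cycle \<open>j - 1\<close>, whose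
    representative is \<open>8 * (j - 1) + 6\<close>.\<close>
  have index: "8 * j - 2 \<in> (\<lambda>j. 8 * j + 6) ` {..<k}" if "0 < j" "j \<le> k" for j
    using that by (intro image_eqI[of _ _ "j - 1"]) auto
  have "scc_of v \<in> scc_of ` (\<lambda>j. 8 * j + 6) ` {..<k}" if "4 \<le> v" "v < 8 * k + 4" for v
  proof (rule vertex_cases[OF that])
    assume "v \<in> {4, 5, 6, 7}"
    then have "scc_of v = scc_of (8 * 0 + 6)"
      using base by auto
    then show ?thesis using k by blast
  next
    fix j assume j: "0 < j" "j < k" "v \<in> {8 * j + 4, 8 * j + 5, 8 * j + 6, 8 * j + 7}"
    \<comment> \<open>The 2-factor separates the rails here: the lower two vertices belong to the
      cycle from below, the upper two start cycle \<open>j\<close>.\<close>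
    have "scc_of (8 * j + 4) = scc_of (8 * j - 2)" "scc_of (8 * j + 5) = scc_of (8 * j - 2)"
      "scc_of (8 * j + 7) = scc_of (8 * j + 6)"
      using rung[OF j(1,2)] path[OF j(1) less_imp_le[OF j(2)]] mid[OF j(1,2)] by argo+
    then have "scc_of v = scc_of (8 * j - 2) \<or> scc_of v = scc_of (8 * j + 6)"
      using j(3) unfolding insert_iff empty_iff by (elim disjE) simp_all
    then show ?thesis
      using index[OF j(1) less_imp_le[OF j(2)]] j(2) by (elim disjE) (simp, blast)
  next
    fix j assume j: "0 < j" "j \<le> k" "v \<in> {8 * j, 8 * j + 1, 8 * j + 2, 8 * j + 3}"
    then have "scc_of v = scc_of (8 * j - 2)"
      using diamond[OF j(1,2)] path[OF j(1,2)] unfolding insert_iff empty_iff by (elim disjE) simp_all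
    then show ?thesis
      using index[OF j(1,2)] by simp
  qed
  then have "sccs_verts \<subseteq> scc_of ` (\<lambda>j. 8 * j + 6) ` {..<k}"
    unfolding sccs_verts_conv_scc_of by auto
  then have "card {S \<in> sccs_verts. 2 \<le> card S} \<le> card (scc_of ` (\<lambda>j. 8 * j + 6) ` {..<k})"
    by (intro card_mono) auto
  also have "\<dots> \<le> k"
    by (metis card_image_le card_lessThan finite_imageI finite_lessThan order_trans)
  finally have "num_nontrivial_components (two_factor k) \<le> k"
    by (simp add: num_nontrivial_components_def)
  moreover have "{v \<in> pverts (two_factor k). out_degree (two_factor k) v = 0} = {}"
    using out_degree_two_factor by fastforce
  then have "num_isolated (two_factor k) = 0"
    by (simp only: num_isolated_def card.empty)
  ultimately show ?thesis
    by (simp add: exc_def)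
qed

section \<open>The exact minimum and the theorem\<close>

lemma minexc_ladder:
  assumes "0 < k"
  shows "minexc (ladder k) = 2 * k"
  unfolding minexc_def
proof (rule Min_eqI)
  show "finite (exc ` spanning_eulerian_subgraphs (ladder k))"
    by (intro finite_imageI finite_spanning_eulerian_subgraphs pair_graph_ladder)
  show "2 * k \<le> m" if "m \<in> exc ` spanning_eulerian_subgraphs (ladder k)" for m
    using that exc_ge_ladder assms by blast
  show "2 * k \<in> exc ` spanning_eulerian_subgraphs (ladder k)"
    using exc_ge_ladder[OF two_factor_spanning_eulerian assms] exc_two_factor_le[OF assms] two_factor_spanning_eulerian
    by (metis image_eqI le_antisym)
qed

theorem proposition31:
  fixes n :: nat
  assumes "n \<ge> 8" and "n mod 8 = 0"
  shows "\<exists>G :: nat pair_pre_digraph.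
    pair_graph G \<and> card (pverts G) = n \<and> two_connected G \<and> cubic G \<and>
    real (minexc G) = real n / 4"
proof -
  obtain k where k: "n = 8 * k" "0 < k"
    using assms by (metis dvd_def mod_0_imp_dvd mult_0_right not_gr_zero not_numeral_le_zero)
  then show ?thesis
    using pair_graph_ladder two_connected_ladder cubic_ladder minexc_ladder
    by (intro exI[of _ "ladder k"]) simp
qed

end
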